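(* For all $m,n\in\mathbb{N}_0$ and every real $x>0$, $$\frac{d^n}{dx^n}\left(\frac{\log^m(x)}{\sqrt{x}}\right)=(-1)^n\frac{(2n)!}{n!\,4^n}\sum_{k=0}^m(-1)^k k!\binom{m}{k}2^k t_n(1_k)\frac{\log^{m-k}(x)}{x^{n+1/2}}.$$
   Context: For a composition $\mathbf{k}=(k_1,\dots,k_r)$ and $n\in\mathbb{N}_0$, $t_n(\mathbf{k})=\sum_{n\ge n_1>\cdots>n_r>0}\prod_j(2n_j-1)^{-k_j}$, with $t_n(\emptyset)=1$ and empty sums equal to $0$. $1_k$ denotes the string of $k$ ones ($1_0=\emptyset$). *)

theory Defs
  imports "HOL-Analysis.Analysis"
begin

text \<open>
  The truncated multiple t-value \<open>t\<^sub>n(k\<^sub>1, \<dots>, k\<^sub>r)\<close>. The list \<open>ns\<close> is the tuple of summation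
  indices \<open>n \<ge> n\<^sub>1 > \<dots> > n\<^sub>r > 0\<close>; for \<open>ks = []\<close> the only index tuple is \<open>[]\<close>, which
  contributes the empty product.
\<close>

definition t_indices :: "nat \<Rightarrow> nat \<Rightarrow> nat list set" where
  "t_indices n r = {ns. length ns = r \<and> sorted_wrt (>) ns \<and> set ns \<subseteq> {1..n}}"

definition t_value :: "nat \<Rightarrow> nat list \<Rightarrow> real" where
  "t_value n ks =
     (\<Sum>ns \<in> t_indices n (length ks). \<Prod>j<length ks. 1 / (2 * real (ns ! j) - 1) ^ (ks ! j))"

lemma finite_t_indices: "finite (t_indices n r)"
  by (rule finite_subset[OF _ finite_lists_length_eq[of "{1..n}" r]]) (auto simp: t_indices_def)

lemma t_value_Nil: "t_value n [] = 1"
proof -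
  have "t_indices n 0 = {[]}"
    by (auto simp: t_indices_def)
  then show ?thesis
    by (simp add: t_value_def)
qed

end

theory Submission
  imports Defs
begin

text \<open>
  Splitting off the index tuples with \<open>n\<^sub>1 = n + 1\<close> gives
  \<open>t\<^bsub>n+1\<^esub>(1\<^bsub>k+1\<^esub>) = t\<^sub>n(1\<^bsub>k+1\<^esub>) + t\<^sub>n(1\<^sub>k) / (2n + 1)\<close>. Differentiating the right-hand side once more
  produces exactly this recurrence in the coefficients of the powers of \<open>log x\<close>, because
  \<open>a\<^sub>k = (-1)\<^sup>k k! (m choose k) 2\<^sup>k\<close> satisfies \<open>a\<^bsub>k+1\<^esub> = -2 (m - k) a\<^sub>k\<close>; the claim follows by
  induction on \<open>n\<close>.
\<close>

lemma t_indices_Suc_Suc: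
  "t_indices (Suc n) (Suc r) = t_indices n (Suc r) \<union> Cons (Suc n) ` t_indices n r"
proof (rule set_eqI)
  fix ns
  show "ns \<in> t_indices (Suc n) (Suc r) \<longleftrightarrow>
      ns \<in> t_indices n (Suc r) \<union> Cons (Suc n) ` t_indices n r"
  proof (cases ns)
    case Nil
    then show ?thesis by (auto simp: t_indices_def)
  next
    case (Cons a as)
    have "ns \<in> Cons (Suc n) ` t_indices n r \<longleftrightarrow> a = Suc n \<and> as \<in> t_indices n r"
      using Cons by auto
    moreover have "ns \<in> t_indices (Suc n) (Suc r) \<and> a = Suc n \<longleftrightarrow> a = Suc n \<and> as \<in> t_indices n r"
      unfolding Cons t_indices_def by (auto simp: subset_iff less_Suc_eq_le)
    \<comment> \<open>The entries decrease, so the head is the largest: once it is at most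
      \<open>n\<close>, the tail lies in \<open>{1..n}\<close> too, and only the head has to be
      compared with \<open>Suc n\<close>.\<close>
    moreover have "ns \<in> t_indices n (Suc r) \<longleftrightarrow> ns \<in> t_indices (Suc n) (Suc r) \<and> a \<noteq> Suc n"
    proof -
      have "set as \<subseteq> {1..n}"
        if "\<forall>b\<in>set as. b < a" "set as \<subseteq> {1..Suc n}" "a \<le> n"
        using that by fastforce
      then show ?thesis
        unfolding Cons t_indices_def by (auto simp: le_Suc_eq)
    qed
    ultimately show ?thesis
      by blast
  qed
qed

text \<open>A head equal to \<open>Suc n\<close> contributes the factor with base 2(n + 1) - 1 = 2n
  + 1, and its tail runs over the index tuples for \<open>ks\<close> bounded by
  \<open>n\<close>.\<close>

lemma t_value_Suc_Cons:
  "t_value (Suc n) (k # ks) = t_value n (k # ks) + t_value n ks / (2 * real n + 1) ^ k"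
proof -
  define F where "F ks ns = (\<Prod>j<length ks. 1 / (2 * real (ns ! j) - 1) ^ (ks ! j))"
    for ks ns :: "nat list"
  have tv: "t_value n ks = (\<Sum>ns \<in> t_indices n (length ks). F ks ns)" for n ks
    by (simp add: t_value_def F_def)
  have F_Cons: "F (k # ks) (a # ns) = F ks ns / (2 * real a - 1) ^ k" for a ns
    by (simp add: F_def prod.lessThan_Suc_shift del: prod.lessThan_Suc)
  have disj: "t_indices n (Suc (length ks)) \<inter> Cons (Suc n) ` t_indices n (length ks) = {}"
    by (auto simp: t_indices_def)
  have "t_value (Suc n) (k # ks) =
      t_value n (k # ks) + (\<Sum>ns \<in> Cons (Suc n) ` t_indices n (length ks). F (k # ks) ns)"
    using disj by (simp add: tv t_indices_Suc_Suc sum.union_disjoint finite_t_indices)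
  also have "(\<Sum>ns \<in> Cons (Suc n) ` t_indices n (length ks). F (k # ks) ns) =
      t_value n ks / (2 * real n + 1) ^ k"
    by (simp add: sum.reindex F_Cons tv sum_divide_distrib add_ac)
  finally show ?thesis .
qed

lemma t_value_0_Cons: "t_value 0 (k # ks) = 0"
proof -
  have "t_indices 0 (Suc r) = {}" for r
    by (auto simp: t_indices_def)
  then show ?thesis
    by (simp add: t_value_def)
qed

text \<open>Since (2n + 2)(2n + 1) = 4(n + 1)(n + 1/2), the factor 4(n + 1) cancels. What remains is
  the exponent of x that differentiation brings down.\<close>

lemma fact_double_Suc_ratio:
  "(fact (2 * Suc n) / (fact (Suc n) * 4 ^ Suc n) :: real) =
     (real n + 1 / 2) * (fact (2 * n) / (fact n * 4 ^ n))"
proof -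
  have "fact (2 * Suc n) = 4 * (real n + 1) * ((real n + 1 / 2) * fact (2 * n))"
    by (simp add: algebra_simps)
  moreover have "fact (Suc n) * 4 ^ Suc n = 4 * (real n + 1) * (fact n * 4 ^ n)"
    by (simp add: algebra_simps)
  moreover have "4 * (real n + 1) \<noteq> 0"
    by (simp add: add_nonneg_eq_0_iff)
  ultimately show ?thesis
    by (metis mult_divide_mult_cancel_left times_divide_eq_right)
qed

text \<open>Both (k + 1) (m choose k + 1) and (m - k) (m choose k) equal m (m - 1 choose k). For k
  \<ge> m both sides vanish, the difference \<open>m - k\<close> being truncated.\<close>

lemma alternating_fact_binomial_Suc:
  "((-1) ^ Suc k * fact (Suc k) * real (m choose Suc k) * 2 ^ Suc k :: real) =
     - 2 * real (m - k) * ((-1) ^ k * fact k * real (m choose k) * 2 ^ k)"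
proof -
  have "real (Suc k) * real (m choose Suc k) = real (m - k) * real (m choose k)"
    by (metis binomial_absorb_comp binomial_absorption of_nat_mult)
  then have "(-1) ^ k * fact k * 2 ^ k * (real (Suc k) * real (m choose Suc k)) =
      (-1) ^ k * fact k * 2 ^ k * (real (m - k) * real (m choose k))"
    by (simp only:)
  then show ?thesis
    by (simp add: algebra_simps)
qed

text \<open>The algebraic core of the induction step: for L = log x the left side is the derivative
  of the sum with the power of x factored out.\<close>

lemma sum_t_value_Suc:
  fixes m n :: nat and L :: real
  defines "a \<equiv> \<lambda>k. (-1) ^ k * fact k * real (m choose k) * 2 ^ k :: real"
  shows "(\<Sum>k=0..m. a k * t_value n (replicate k 1) *
             (real (m - k) * L ^ (m - k - 1) - (real n + 1 / 2) * L ^ (m - k))) =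
         - (real n + 1 / 2) * (\<Sum>k=0..m. a k * t_value (Suc n) (replicate k 1) * L ^ (m - k))"
proof -
  define T where "T n k = t_value n (replicate k 1)" for n k
  have T0: "T n 0 = 1" for n
    by (simp add: T_def t_value_Nil)
  \<comment> \<open>Multiplying by n + 1/2 turns the weight 1/(2n + 1) into 1/2, which matches the
    1/2 in \<open>aS\<close>.\<close>
  have TS: "(real n + 1 / 2) * T (Suc n) (Suc k) = (real n + 1 / 2) * T n (Suc k) + T n k / 2" for k
    by (simp add: T_def t_value_Suc_Cons field_simps)
  have aS: "real (m - k) * a k = - a (Suc k) / 2" for k
    unfolding a_def alternating_fact_binomial_Suc by simp
  define c where "c = real n + 1 / 2"
  \<comment> \<open>The factor \<open>m - k\<close> kills the term k = m, where the exponent is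
    truncated; elsewhere \<open>aS\<close> absorbs it into the next coefficient.\<close>
  have top: "(\<Sum>k\<le>m. a k * T n k * (real (m - k) * L ^ (m - k - 1))) =
      (\<Sum>k<m. - a (Suc k) * (T n k / 2) * L ^ (m - Suc k))"
  proof -
    have "(\<Sum>k\<le>m. a k * T n k * (real (m - k) * L ^ (m - k - 1))) =
        (\<Sum>k<m. a k * T n k * (real (m - k) * L ^ (m - k - 1)))"
      by (simp add: lessThan_Suc_atMost[symmetric])
    also have "\<dots> = (\<Sum>k<m. (real (m - k) * a k) * T n k * L ^ (m - Suc k))"
      by (simp add: mult_ac)
    finally show ?thesis
      unfolding aS by simp
  qed
  \<comment> \<open>Peeling off k = 0, where \<open>T n 0 = 1\<close> for every \<open>n\<close>,
    aligns the remaining powers of L with those in \<open>top\<close>, so that \<open>TS\<close>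
    applies termwise.\<close>
  have shift: "(\<Sum>k\<le>m. f k) = f 0 + (\<Sum>k<m. f (Suc k))" for f :: "nat \<Rightarrow> real"
    by (simp add: lessThan_Suc_atMost[symmetric] sum.lessThan_Suc_shift del: sum.lessThan_Suc)
  have "(\<Sum>k\<le>m. a k * T n k * (real (m - k) * L ^ (m - k - 1) - c * L ^ (m - k))) =
      (\<Sum>k<m. - a (Suc k) * (T n k / 2) * L ^ (m - Suc k))
      - c * (\<Sum>k\<le>m. a k * T n k * L ^ (m - k))"
    unfolding top[symmetric] by (simp add: right_diff_distrib sum_subtractf sum_distrib_left mult_ac)
  also have "\<dots> = - c * (a 0 * L ^ m)
      - (\<Sum>k<m. a (Suc k) * (c * T n (Suc k) + T n k / 2) * L ^ (m - Suc k))"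
    unfolding shift[of "\<lambda>k. a k * T n k * L ^ (m - k)"]
    by (simp add: T0 algebra_simps sum.distrib sum_negf sum_distrib_left)
  also have "\<dots> = - c * (\<Sum>k\<le>m. a k * T (Suc n) k * L ^ (m - k))"
    unfolding shift[of "\<lambda>k. a k * T (Suc n) k * L ^ (m - k)"] TS[folded c_def, symmetric]
    by (simp add: T0 algebra_simps sum_distrib_left sum_negf)
  finally show ?thesis
    by (simp add: T_def c_def atLeast0AtMost)
qed

lemma DERIV_ln_power_div_powr:
  fixes x :: real
  assumes "x > 0"
  shows "((\<lambda>y. ln y ^ p / y powr s) has_real_derivative
      (real p * ln x ^ (p - 1) - s * ln x ^ p) / x powr (s + 1)) (at x)"
proof -
  have "((\<lambda>y. ln y ^ p * y powr (- s)) has_real_derivative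
      real p * ln x ^ (p - 1) * (1 / x) * x powr (- s) + ln x ^ p * (- s * x powr (- s - 1))) (at x)"
    using assms by (auto intro!: derivative_eq_intros)
  moreover have "real p * ln x ^ (p - 1) * (1 / x) * x powr (- s) +
      ln x ^ p * (- s * x powr (- s - 1)) =
      (real p * ln x ^ (p - 1) - s * ln x ^ p) / x powr (s + 1)"
    using assms by (simp add: powr_diff powr_add powr_minus field_simps)
  ultimately show ?thesis
    by (simp add: powr_minus divide_inverse)
qed

theorem theorem4p2:
  fixes m n :: nat and x :: real
  assumes "x > 0"
  shows "(deriv ^^ n) (\<lambda>y::real. ln y ^ m / sqrt y) x =
    (-1) ^ n * (fact (2 * n) / (fact n * 4 ^ n)) *
    (\<Sum>k=0..m. (-1) ^ k * fact k * real (m choose k) * 2 ^ k * t_value n (replicate k 1) *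
       (ln x ^ (m - k) / x powr (real n + 1 / 2)))"
  using assms
proof (induction n arbitrary: x)
  case 0
  have "(\<Sum>k=0..m. (-1) ^ k * fact k * real (m choose k) * 2 ^ k * t_value 0 (replicate k 1) *
       (ln x ^ (m - k) / x powr (1 / 2))) = ln x ^ m / x powr (1 / 2)"
    \<comment> \<open>Only k = 0 survives, because \<open>t_value 0\<close> vanishes on nonempty
      lists.\<close>
    by (subst sum.atLeast_Suc_atMost) (auto simp: t_value_Nil t_value_0_Cons Suc_le_eq gr0_conv_Suc
        intro!: sum.neutral)
  then show ?case
    using 0 by (simp add: powr_half_sqrt)
next
  case (Suc n)
  define a where "a k = ((-1) ^ k * fact k * real (m choose k) * 2 ^ k :: real)" for k
  define c where "c = (fact (2 * n) / (fact n * 4 ^ n) :: real)"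
  define G where "G y = (-1) ^ n * c * (\<Sum>k=0..m. a k * t_value n (replicate k 1) *
      (ln y ^ (m - k) / y powr (real n + 1 / 2)))" for y
  define S where "S = (\<Sum>k=0..m. a k * t_value (Suc n) (replicate k 1) * ln x ^ (m - k))"
  define X where "X = x powr (real (Suc n) + 1 / 2)"
  have X: "x powr (real n + 1 / 2 + 1) = X"
    by (simp add: X_def add_ac)
  have "(G has_real_derivative (-1) ^ n * c * (\<Sum>k=0..m. a k * t_value n (replicate k 1) *
      ((real (m - k) * ln x ^ (m - k - 1) - (real n + 1 / 2) * ln x ^ (m - k)) / X))) (at x)"
    unfolding G_def X[symmetric]
    by (intro DERIV_cmult DERIV_sum DERIV_ln_power_div_powr Suc.prems)
  then have "deriv G x = (-1) ^ n * c * (\<Sum>k=0..m. a k * t_value n (replicate k 1) *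
      ((real (m - k) * ln x ^ (m - k - 1) - (real n + 1 / 2) * ln x ^ (m - k)) / X))"
    by (rule DERIV_imp_deriv)
  also have "\<dots> = (-1) ^ n * c * ((\<Sum>k=0..m. a k * t_value n (replicate k 1) *
      (real (m - k) * ln x ^ (m - k - 1) - (real n + 1 / 2) * ln x ^ (m - k))) / X)"
    by (simp only: sum_divide_distrib times_divide_eq_right)
  also have "\<dots> = (-1) ^ n * c * (- (real n + 1 / 2) * S / X)"
    unfolding a_def sum_t_value_Suc S_def ..
  also have "\<dots> = (-1) ^ Suc n * ((real n + 1 / 2) * c) * (S / X)"
    by (simp add: mult_ac del: minus_add_distrib)
  also have "S / X = (\<Sum>k=0..m. a k * t_value (Suc n) (replicate k 1) * (ln x ^ (m - k) / X))"
    by (simp only: S_def sum_divide_distrib times_divide_eq_right)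
  finally have G': "deriv G x = (-1) ^ Suc n * ((real n + 1 / 2) * c) *
      (\<Sum>k=0..m. a k * t_value (Suc n) (replicate k 1) *
        (ln x ^ (m - k) / x powr (real (Suc n) + 1 / 2)))"
    unfolding X_def .
  \<comment> \<open>Equality at \<open>x\<close> alone would not determine the derivative. The
    induction hypothesis, kept general in the point, gives it on the open half-line around
    \<open>x\<close>.\<close>
  have "\<forall>\<^sub>F y in nhds x. (deriv ^^ n) (\<lambda>y::real. ln y ^ m / sqrt y) y = G y"
    using eventually_nhds_in_open[OF open_greaterThan, of x 0] Suc.prems
    by (auto elim!: eventually_mono simp: Suc.IH G_def a_def c_def)
  then have "(deriv ^^ Suc n) (\<lambda>y::real. ln y ^ m / sqrt y) x = deriv G x"
    by (simp add: deriv_cong_ev)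
  then show ?case
    unfolding G' fact_double_Suc_ratio a_def c_def .
qed

end
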